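(* Let $H$ be a reproducing kernel Hilbert space on a set $X$ and let $\mathfrak{A}$ be a dual algebra of multipliers on $H$ with property $\mathbb{A}_1(1)$. Let $E$ be a finite subset of $X$ which is separated by $\mathfrak{A}$. Then for every $f\in\mathfrak{A}$, \[ \operatorname{dist}(f,\mathfrak{J}_E)=\sup\big\{ \| P_{N_L}M_f^*|_{N_L}\| : L\in\operatorname{CycLat}(\mathfrak{A})\big\}, \] where $N_L=L\ominus\mathfrak{J}_EL$. That is, $\{k^L: L\in\operatorname{CycLat}(\mathfrak{A})\}$ is a Nevanlinna-Pick family of kernels for $\mathfrak{A}$.
   Context: $H$ is a Hilbert space of complex-valued functions on $X$ with reproducing kernels $k_\lambda\ne0$, $h(\lambda)=\langle h,k_\lambda\rangle$. The multiplier algebra is $\mathfrak{M}(H)=\{f:X\to\mathbb{C}: fh\in H\ \forall h\in H\}$; each $f\in\mathfrak{M}(H)$ is identified with the bounded operator $M_f h=fh$. A dual algebra of multipliers $\mathfrak{A}$ on $H$ is a subalgebra of $\mathfrak{M}(H)\subset\mathcal{B}(H)$ containing $I$ and closed in the weak-$*$ topology of $\mathcal{B}(H)$. Property $\mathbb{A}_1(1)$: for every weak-$*$ continuous functional $\varphi$ on $\mathfrak{A}$ with $\|\varphi\|<1$ there are $x,y\in H$ with $\|x\|\|y\|<1$ and $\varphi(A)=\langle Ax,y\rangle$ for all $A\in\mathfrak{A}$. $\mathfrak{A}$ separates $E$ if for distinct $\lambda,\mu\in E$ some $f\in\mathfrak{A}$ has $f(\lambda)\neq f(\mu)$. $\mathfrak{J}_E=\{f\in\mathfrak{A}: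 f|_E=0\}$, $\mathfrak{J}_\lambda=\mathfrak{J}_{\{\lambda\}}$, $\operatorname{dist}(f,\mathfrak{J}_E)=\inf_{g\in\mathfrak{J}_E}\|M_f-M_g\|$. $\operatorname{CycLat}(\mathfrak{A})$ is the set of cyclic invariant subspaces $\mathfrak{A}[h]=\overline{\mathfrak{A}h}$, $h\in H$; also $\mathfrak{J}_\lambda[h]=\overline{\mathfrak{J}_\lambda h}$. $L\ominus\mathfrak{J}_EL$ is the set of vectors in $L$ orthogonal to all $gx$, $g\in\mathfrak{J}_E$, $x\in L$. $P_N$ is the orthogonal projection onto $N$. For $L=\mathfrak{A}[h]$, the kernel $k^L$ is defined by: $k^L_\lambda=P_Lk_\lambda$ if this is nonzero (equivalently $h(\lambda)\ne0$); if $P_Lk_\lambda=0$ but $\mathfrak{J}_\lambda[h]\neq\mathfrak{A}[h]$, then $k^L_\lambda$ is a chosen unit vector in the one-dimensional space $\mathfrak{A}[h]\ominus\mathfrak{J}_\lambda[h]$; otherwise $k^L_\lambda=0$. The collection $\{k^L: L\in\operatorname{CycLat}(\mathfrak{A})\}$ is called a Nevanlinna-Pick family of kernels for $\mathfrak{A}$ if for every finite $E\subset X$ and $f\in\mathfrak{A}$, $\operatorname{dist}(f,\mathfrak{J}_E)=\sup_{L\in\operatorname{CycLat}(\mathfrak{A})}\|P_{N_L}M_f^*|_{N_L}\|$ with $N_L=L\ominus\mathfrak{J}_EL$. *)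

theory Defs
  imports "HOL-Analysis.Analysis"
begin

section \<open>Complex Hilbert spaces\<close>

class scaleC =
  fixes scaleC :: "complex \<Rightarrow> 'a \<Rightarrow> 'a" (infixr "*\<^sub>C" 75)

text \<open>
  The norm, metric and topology are those of the underlying real Hilbert space, whose
  inner product is the real part of \<open>cinner\<close>; together with \<open>cinner_commute\<close>
  this gives \<open>cinner x x = (norm x)\<^sup>2\<close>. The inner product is linear in its first argument.
\<close>

class complex_hilbert = real_inner + complete_space + scaleC +
  fixes cinner :: "'a \<Rightarrow> 'a \<Rightarrow> complex"
  assumes scaleR_scaleC: "r *\<^sub>R x = complex_of_real r *\<^sub>C x"
    and scaleC_add_right: "c *\<^sub>C (x + y) = c *\<^sub>C x + c *\<^sub>C y"
    and scaleC_add_left: "(c + d) *\<^sub>C x = c *\<^sub>C x + d *\<^sub>C x"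
    and scaleC_scaleC: "c *\<^sub>C (d *\<^sub>C x) = (c * d) *\<^sub>C x"
    and cinner_commute: "cinner x y = cnj (cinner y x)"
    and cinner_add_left: "cinner (x + y) z = cinner x z + cinner y z"
    and cinner_scaleC_left: "cinner (c *\<^sub>C x) y = c * cinner x y"
    and inner_eq_Re_cinner: "inner x y = Re (cinner x y)"

instantiation complex :: complex_hilbert
begin

definition "scaleC_complex (c :: complex) (x :: complex) = c * x"

definition "cinner_complex (x :: complex) (y :: complex) = x * cnj y"

instance
  by standard
    (auto simp: scaleC_complex_def cinner_complex_def scaleR_conv_of_real inner_complex_def
      algebra_simps)

end

definition bounded_ops :: "('h::complex_hilbert \<Rightarrow> 'h) set" where
  "bounded_ops = {A. bounded_linear A \<and> (\<forall>c x. A (c *\<^sub>C x) = c *\<^sub>C A x)}"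

definition hilbert_adjoint :: "('h::complex_hilbert \<Rightarrow> 'h) \<Rightarrow> 'h \<Rightarrow> 'h" where
  "hilbert_adjoint A = (THE B. \<forall>x y. cinner (A x) y = cinner x (B y))"

text \<open>Orthogonal projection onto a closed (complex) subspace \<open>N\<close>.\<close>

definition orth_proj :: "'h::complex_hilbert set \<Rightarrow> 'h \<Rightarrow> 'h" where
  "orth_proj N x = (THE y. y \<in> N \<and> (\<forall>z\<in>N. cinner (x - y) z = 0))"

definition orth_diff :: "'h::complex_hilbert set \<Rightarrow> 'h set \<Rightarrow> 'h set" (infixl "\<ominus>" 65) where
  "L \<ominus> S = {x \<in> L. \<forall>y\<in>S. cinner x y = 0}"

text \<open>Operator norm of the restriction of \<open>T\<close> to the subspace \<open>N\<close>.\<close>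

definition restr_norm :: "'h::complex_hilbert set \<Rightarrow> ('h \<Rightarrow> 'h) \<Rightarrow> real" where
  "restr_norm N T = (SUP x\<in>{x \<in> N. norm x \<le> 1}. norm (T x))"

text \<open>
  The predual of the bounded operators consists of the trace class operators. These are the
  operators \<open>T z = (\<Sum>n. cinner z (y n) *\<^sub>C x n)\<close> with square-summable
  \<open>norm (x n)\<close> and \<open>norm (y n)\<close>, and such a \<open>T\<close> acts on \<open>A\<close> as the trace of \<open>A T\<close>,
  which is \<open>\<Sum>n. cinner (A (x n)) (y n)\<close>.
\<close>

definition predual_functionals :: "(('h::complex_hilbert \<Rightarrow> 'h) \<Rightarrow> complex) set" where
  "predual_functionals =
    {\<omega>. \<exists>x y :: nat \<Rightarrow> 'h.
        summable (\<lambda>n. (norm (x n))\<^sup>2) \<and> summable (\<lambda>n. (norm (y n))\<^sup>2) \<and>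
        \<omega> = (\<lambda>A. \<Sum>n. cinner (A (x n)) (y n))}"

text \<open>The topological space below has carrier \<^const>\<open>bounded_ops\<close>.\<close>

definition weak_star_topology :: "('h::complex_hilbert \<Rightarrow> 'h) topology" where
  "weak_star_topology =
    topology_generated_by
      {{A \<in> bounded_ops. \<omega> A \<in> U} | \<omega> U. \<omega> \<in> predual_functionals \<and> open U}"


section \<open>Reproducing kernel Hilbert spaces and their multipliers\<close>

text \<open>
  A Hilbert space of functions on \<open>'x\<close> is given by a complex Hilbert space \<open>'h\<close> and an injective
  map \<open>ev\<close> sending each \<open>h\<close> to the function it is identified with. Linearity of
  \<open>ev\<close> follows from the reproducing property.
\<close>

definition rkhs :: "('h::complex_hilbert \<Rightarrow> 'x \<Rightarrow> complex) \<Rightarrow> ('x \<Rightarrow> 'h) \<Rightarrow> bool" where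
  "rkhs ev k \<longleftrightarrow>
    inj ev \<and> (\<forall>h l. ev h l = cinner h (k l)) \<and> (\<forall>l. k l \<noteq> 0)"

definition multipliers :: "('h::complex_hilbert \<Rightarrow> 'x \<Rightarrow> complex) \<Rightarrow> ('x \<Rightarrow> complex) set" where
  "multipliers ev = {f. \<forall>h. (\<lambda>x. f x * ev h x) \<in> range ev}"

definition mult_op ::
    "('h::complex_hilbert \<Rightarrow> 'x \<Rightarrow> complex) \<Rightarrow> ('x \<Rightarrow> complex) \<Rightarrow> 'h \<Rightarrow> 'h" where
  "mult_op ev f h = inv ev (\<lambda>x. f x * ev h x)"

text \<open>
  Being closed in \<^const>\<open>weak_star_topology\<close> includes being contained in its carrier
  \<^const>\<open>bounded_ops\<close>.
\<close>

definition dual_algebra ::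
    "('h::complex_hilbert \<Rightarrow> 'x \<Rightarrow> complex) \<Rightarrow> ('x \<Rightarrow> complex) set \<Rightarrow> bool" where
  "dual_algebra ev \<AA> \<longleftrightarrow>
    \<AA> \<subseteq> multipliers ev \<and>
    (\<lambda>x. 1) \<in> \<AA> \<and>
    (\<forall>f\<in>\<AA>. \<forall>g\<in>\<AA>. (\<lambda>x. f x + g x) \<in> \<AA>) \<and>
    (\<forall>f\<in>\<AA>. \<forall>g\<in>\<AA>. (\<lambda>x. f x * g x) \<in> \<AA>) \<and>
    (\<forall>c. \<forall>f\<in>\<AA>. (\<lambda>x. c * f x) \<in> \<AA>) \<and>
    closedin weak_star_topology (mult_op ev ` \<AA>)"

definition functional_on :: "('x \<Rightarrow> complex) set \<Rightarrow> (('x \<Rightarrow> complex) \<Rightarrow> complex) \<Rightarrow> bool" where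
  "functional_on \<AA> \<phi> \<longleftrightarrow>
    (\<forall>f\<in>\<AA>. \<forall>g\<in>\<AA>. \<phi> (\<lambda>x. f x + g x) = \<phi> f + \<phi> g) \<and>
    (\<forall>c. \<forall>f\<in>\<AA>. \<phi> (\<lambda>x. c * f x) = c * \<phi> f)"

definition weak_star_continuous_on ::
    "('h::complex_hilbert \<Rightarrow> 'x \<Rightarrow> complex) \<Rightarrow> ('x \<Rightarrow> complex) set
      \<Rightarrow> (('x \<Rightarrow> complex) \<Rightarrow> complex) \<Rightarrow> bool" where
  "weak_star_continuous_on ev \<AA> \<phi> \<longleftrightarrow>
    continuous_map (pullback_topology \<AA> (mult_op ev) weak_star_topology) euclidean \<phi>"

definition functional_norm ::
    "('h::complex_hilbert \<Rightarrow> 'x \<Rightarrow> complex) \<Rightarrow> ('x \<Rightarrow> complex) set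
      \<Rightarrow> (('x \<Rightarrow> complex) \<Rightarrow> complex) \<Rightarrow> real" where
  "functional_norm ev \<AA> \<phi> = (SUP f\<in>{f \<in> \<AA>. onorm (mult_op ev f) \<le> 1}. norm (\<phi> f))"

definition property_A1_1 ::
    "('h::complex_hilbert \<Rightarrow> 'x \<Rightarrow> complex) \<Rightarrow> ('x \<Rightarrow> complex) set \<Rightarrow> bool" where
  "property_A1_1 ev \<AA> \<longleftrightarrow>
    (\<forall>\<phi>. functional_on \<AA> \<phi> \<and> weak_star_continuous_on ev \<AA> \<phi> \<and> functional_norm ev \<AA> \<phi> < 1 \<longrightarrow>
      (\<exists>x y. norm x * norm y < 1 \<and> (\<forall>f\<in>\<AA>. \<phi> f = cinner (mult_op ev f x) y)))"

definition separates :: "('x \<Rightarrow> complex) set \<Rightarrow> 'x set \<Rightarrow> bool" where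
  "separates \<AA> E \<longleftrightarrow> (\<forall>l\<in>E. \<forall>m\<in>E. l \<noteq> m \<longrightarrow> (\<exists>f\<in>\<AA>. f l \<noteq> f m))"

definition vanishing_ideal :: "('x \<Rightarrow> complex) set \<Rightarrow> 'x set \<Rightarrow> ('x \<Rightarrow> complex) set" where
  "vanishing_ideal \<AA> E = {f \<in> \<AA>. \<forall>l\<in>E. f l = 0}"

definition mult_dist ::
    "('h::complex_hilbert \<Rightarrow> 'x \<Rightarrow> complex) \<Rightarrow> ('x \<Rightarrow> complex) \<Rightarrow> ('x \<Rightarrow> complex) set \<Rightarrow> real" where
  "mult_dist ev f J = (INF g\<in>J. onorm (\<lambda>h. mult_op ev f h - mult_op ev g h))"


section \<open>Cyclic subspaces and Nevanlinna-Pick families\<close>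

definition cyclic ::
    "('h::complex_hilbert \<Rightarrow> 'x \<Rightarrow> complex) \<Rightarrow> ('x \<Rightarrow> complex) set \<Rightarrow> 'h \<Rightarrow> 'h set" where
  "cyclic ev S h = closure ((\<lambda>f. mult_op ev f h) ` S)"

definition CycLat ::
    "('h::complex_hilbert \<Rightarrow> 'x \<Rightarrow> complex) \<Rightarrow> ('x \<Rightarrow> complex) set \<Rightarrow> 'h set set" where
  "CycLat ev \<AA> = range (cyclic ev \<AA>)"

definition NP_space ::
    "('h::complex_hilbert \<Rightarrow> 'x \<Rightarrow> complex) \<Rightarrow> ('x \<Rightarrow> complex) set \<Rightarrow> 'x set \<Rightarrow> 'h set \<Rightarrow> 'h set" where
  "NP_space ev \<AA> E L = L \<ominus> {mult_op ev g x | g x. g \<in> vanishing_ideal \<AA> E \<and> x \<in> L}"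

text \<open>
  For \<open>f \<in> \<AA>\<close> the suprema are over sets bounded above by \<open>onorm (mult_op ev f)\<close>, and
  \<^const>\<open>CycLat\<close> is never empty.
\<close>

definition NP_formula ::
    "('h::complex_hilbert \<Rightarrow> 'x \<Rightarrow> complex) \<Rightarrow> ('x \<Rightarrow> complex) set \<Rightarrow> 'x set
      \<Rightarrow> ('x \<Rightarrow> complex) \<Rightarrow> bool" where
  "NP_formula ev \<AA> E f \<longleftrightarrow>
    mult_dist ev f (vanishing_ideal \<AA> E) =
      (SUP L\<in>CycLat ev \<AA>.
        restr_norm (NP_space ev \<AA> E L)
          (\<lambda>x. orth_proj (NP_space ev \<AA> E L) (hilbert_adjoint (mult_op ev f) x)))"

text \<open>
  \<open>\<kappa>\<close> is a kernel for \<open>L = cyclic ev \<AA> h\<close>. It is not unique: where the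
  projection of \<open>k l\<close> vanishes, the unit vector may be chosen freely.
\<close>

definition cyclic_kernel ::
    "('h::complex_hilbert \<Rightarrow> 'x \<Rightarrow> complex) \<Rightarrow> ('x \<Rightarrow> 'h) \<Rightarrow> ('x \<Rightarrow> complex) set \<Rightarrow> 'h
      \<Rightarrow> ('x \<Rightarrow> 'h) \<Rightarrow> bool" where
  "cyclic_kernel ev k \<AA> h \<kappa> \<longleftrightarrow>
    (\<forall>l. let L = cyclic ev \<AA> h; M = cyclic ev (vanishing_ideal \<AA> {l}) h in
      if orth_proj L (k l) \<noteq> 0 then \<kappa> l = orth_proj L (k l)
      else if M \<noteq> L then \<kappa> l \<in> L \<ominus> M \<and> norm (\<kappa> l) = 1
      else \<kappa> l = 0)"

text \<open>
  \<open>K L\<close> plays the role of $k^L$. Which generator \<open>h\<close> of \<open>L\<close> is used is irrelevant, since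
  \<open>cyclic ev (vanishing_ideal \<AA> {l}) h\<close> depends only on \<open>cyclic ev \<AA> h\<close>.
\<close>

definition kernel_family ::
    "('h::complex_hilbert \<Rightarrow> 'x \<Rightarrow> complex) \<Rightarrow> ('x \<Rightarrow> 'h) \<Rightarrow> ('x \<Rightarrow> complex) set
      \<Rightarrow> ('h set \<Rightarrow> 'x \<Rightarrow> 'h) \<Rightarrow> bool" where
  "kernel_family ev k \<AA> K \<longleftrightarrow>
    (\<forall>L\<in>CycLat ev \<AA>. \<exists>h. L = cyclic ev \<AA> h \<and> cyclic_kernel ev k \<AA> h (K L))"

definition nevanlinna_pick_family ::
    "('h::complex_hilbert \<Rightarrow> 'x \<Rightarrow> complex) \<Rightarrow> ('x \<Rightarrow> 'h) \<Rightarrow> ('x \<Rightarrow> complex) set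
      \<Rightarrow> ('h set \<Rightarrow> 'x \<Rightarrow> 'h) \<Rightarrow> bool" where
  "nevanlinna_pick_family ev k \<AA> K \<longleftrightarrow>
    kernel_family ev k \<AA> K \<and>
    (\<forall>E f. finite E \<and> f \<in> \<AA> \<longrightarrow> NP_formula ev \<AA> E f)"

end

theory Submission
  imports Defs
begin

text \<open>
  Write \<open>J\<close> for the ideal of multipliers vanishing on \<open>E\<close> and \<open>N = L \<ominus> J L\<close> for a cyclic subspace \<open>L\<close>.

  The distance dominates every compression: if \<open>g \<in> J\<close>, then \<open>M g\<close> maps \<open>L\<close> into \<open>J L\<close>, which is orthogonal
  to \<open>N\<close>. So \<open>f\<close> and \<open>f - g\<close> have the same compressed adjoint on \<open>N\<close>
  (\<open>norm_compression_le\<close>).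

  For the converse, the Hahn-Banach theorem gives a functional \<open>\<psi>\<close> on \<open>\<AA>\<close> of norm at most one that
  vanishes on \<open>J\<close> and takes the value \<open>dist(f, J)\<close> at \<open>f\<close> (\<open>norming_functional_exists\<close>). Because \<open>J\<close> is the
  common kernel of finitely many point evaluations, \<open>\<psi>\<close> is a linear combination of them
  (\<open>functional_vanishing_on_ideal\<close>). Point evaluations are vector states at the kernel functions, so
  \<open>\<psi>\<close> is weak-* continuous. For \<open>0 < r < 1\<close> the property \<open>\<AA>\<^sub>1(1)\<close> therefore
  represents \<open>r \<psi>\<close> as \<open>g \<mapsto> cinner (M g x) y\<close> with \<open>norm x * norm y < 1\<close>.

  Take \<open>L = \<AA>[x]\<close> and project \<open>y\<close> to \<open>L\<close>, which does not change the functional. Since the functional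
  vanishes on the ideal \<open>J\<close>, the projected vector lies in \<open>N\<close> (\<open>orth_proj_in_N\<close>). Moreover, projecting
  the adjoint of \<open>M f\<close> from \<open>N\<close> to \<open>L\<close> already lands in \<open>N\<close>
  (\<open>compression_eq_orth_proj_cyclic\<close>), so \<open>cinner (M f x) y\<close> is the inner product of \<open>x\<close> with the compressed
  adjoint applied to a vector of \<open>N\<close>. Its modulus is at most the norm of the compression on this one \<open>L\<close>, and
  \<open>r \<rightarrow> 1\<close> finishes the proof.

  Being a Nevanlinna-Pick family means this formula at every finite set of points, so the statement
  about families of kernels follows by letting \<open>E\<close> vary.
\<close>

section \<open>Complex Hilbert spaces\<close>

lemma cinner_scaleC_right: "cinner x (c *\<^sub>C y) = cnj c * cinner x y"
  by (subst (1 2) cinner_commute) (simp add: cinner_scaleC_left)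

lemma scaleC_minus_one: "(- 1::complex) *\<^sub>C (x::'a::complex_hilbert) = - x"
  using scaleR_scaleC[of "-1" x] by simp

lemma cinner_scaleR_left: "cinner (r *\<^sub>R x) y = of_real r * cinner x y"
  by (simp add: scaleR_scaleC cinner_scaleC_left)

lemma cinner_minus_left [simp]: "cinner (- x) y = - cinner x y"
  using cinner_scaleR_left[of "-1" x y] by simp

lemma cinner_diff_left: "cinner (x - y) z = cinner x z - cinner y z"
  using cinner_add_left[of x "- y" z] by simp

lemma cinner_diff_right: "cinner x (y - z) = cinner x y - cinner x z"
  by (subst (1 2 3) cinner_commute) (simp add: cinner_diff_left)

lemma cinner_zero_left [simp]: "cinner 0 x = 0"
  using cinner_diff_left[of 0 0 x] by simp

lemma cinner_zero_right [simp]: "cinner x 0 = 0"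
  using cinner_diff_right[of x 0 0] by simp

lemma cinner_self: "cinner x x = complex_of_real ((norm x)\<^sup>2)"
proof -
  have "Im (cinner x x) = 0"
    using arg_cong[OF cinner_commute[of x x], of Im] by simp
  moreover have "Re (cinner x x) = (norm x)\<^sup>2"
    by (simp add: inner_eq_Re_cinner[symmetric] power2_norm_eq_inner)
  ultimately show ?thesis by (simp add: complex_eq_iff)
qed

lemma cinner_eqI:
  assumes "\<And>z. cinner x z = cinner y z"
  shows "x = y"
  using assms[of "x - y"] cinner_self[of "x - y"] by (simp add: cinner_diff_left)

lemma norm_scaleC: "norm (c *\<^sub>C (x::'a::complex_hilbert)) = norm c * norm x"
proof -
  have "complex_of_real ((norm (c *\<^sub>C x))\<^sup>2) = c * cnj c * cinner x x"
    unfolding cinner_self[symmetric] by (simp add: cinner_scaleC_left cinner_scaleC_right)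
  also have "\<dots> = complex_of_real ((norm c * norm x)\<^sup>2)"
    by (simp add: cinner_self complex_norm_square[symmetric] power_mult_distrib)
  finally have "(norm (c *\<^sub>C x))\<^sup>2 = (norm c * norm x)\<^sup>2"
    by (simp only: of_real_eq_iff)
  thus ?thesis by (simp add: power2_eq_iff_nonneg)
qed

lemma rotate_to_norm:
  obtains u :: complex where "norm u = 1" "u * z = of_real (norm z)"
proof (cases "z = 0")
  case True
  thus ?thesis using that[of 1] by simp
next
  case False
  show ?thesis
  proof (rule that[of "cnj z / of_real (norm z)"])
    show "norm (cnj z / of_real (norm z)) = 1" using False by (simp add: norm_divide)
    show "cnj z / of_real (norm z) * z = of_real (norm z)"
      using False by (simp add: field_simps complex_norm_square[symmetric] power2_eq_square)
  qed
qed

lemma cinner_Cauchy_Schwarz: "norm (cinner x y) \<le> norm x * norm y"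
proof -
  obtain u where u: "norm u = 1" "u * cinner x y = of_real (norm (cinner x y))"
    by (rule rotate_to_norm)
  have "norm (cinner x y) = inner (u *\<^sub>C x) y"
    by (simp add: inner_eq_Re_cinner cinner_scaleC_left u)
  also have "\<dots> \<le> norm (u *\<^sub>C x) * norm y" by (rule norm_cauchy_schwarz)
  finally show ?thesis by (simp add: norm_scaleC u)
qed

lemma continuous_cinner_left: "continuous_on S (\<lambda>x. cinner x y)"
proof -
  have "bounded_linear (\<lambda>x. cinner x y)"
    by (rule bounded_linear_intro[where K="norm y"])
      (auto simp: cinner_add_left cinner_scaleR_left scaleR_conv_of_real cinner_Cauchy_Schwarz)
  thus ?thesis by (rule linear_continuous_on)
qed

lemma bounded_linear_scaleC: "bounded_linear (\<lambda>x. c *\<^sub>C (x::'a::complex_hilbert))"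
  by (rule bounded_linear_intro[where K="norm c"])
    (auto simp: scaleC_add_right scaleR_scaleC scaleC_scaleC norm_scaleC mult.commute)

definition csubspace :: "'a::complex_hilbert set \<Rightarrow> bool" where
  "csubspace N \<longleftrightarrow> 0 \<in> N \<and> (\<forall>x\<in>N. \<forall>y\<in>N. x + y \<in> N) \<and> (\<forall>c. \<forall>x\<in>N. c *\<^sub>C x \<in> N)"

lemma csubspace_imp_subspace: "csubspace N \<Longrightarrow> subspace N"
  by (auto simp: csubspace_def subspace_def scaleR_scaleC)

text \<open>
  Over a complex subspace, orthogonality for the real inner product already gives
  orthogonality for \<open>cinner\<close>: rotate the second argument.
\<close>

lemma csubspace_orthogonalI:
  assumes "csubspace N" "\<And>z. z \<in> N \<Longrightarrow> inner x z = 0" "z \<in> N"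
  shows "cinner x z = 0"
proof -
  obtain u where u: "norm u = 1" "u * cinner x z = of_real (norm (cinner x z))"
    by (rule rotate_to_norm)
  have "inner x (cnj u *\<^sub>C z) = 0" using assms by (auto simp: csubspace_def)
  hence "norm (cinner x z) = 0"
    by (simp add: inner_eq_Re_cinner cinner_scaleC_right u)
  thus ?thesis by simp
qed

lemma csubspace_closure:
  assumes S: "csubspace S"
  shows "csubspace (closure S)"
  unfolding csubspace_def
proof (intro conjI ballI allI)
  show "0 \<in> closure S" using S closure_subset by (auto simp: csubspace_def)
next
  fix x y assume "x \<in> closure S" "y \<in> closure S"
  then obtain a b where "\<And>n::nat. a n \<in> S" "a \<longlonglongrightarrow> x" "\<And>n::nat. b n \<in> S" "b \<longlonglongrightarrow> y"
    unfolding closure_sequential by auto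
  thus "x + y \<in> closure S" unfolding closure_sequential
    using S by (intro exI[of _ "\<lambda>n. a n + b n"]) (auto simp: csubspace_def intro: tendsto_add)
next
  fix c x assume x: "x \<in> closure S"
  have "c *\<^sub>C x \<in> closure ((\<lambda>x. c *\<^sub>C x) ` S)"
    using closure_bounded_linear_image_subset[OF bounded_linear_scaleC, of c S] x by blast
  also have "\<dots> \<subseteq> closure S" using S by (intro closure_mono) (auto simp: csubspace_def)
  finally show "c *\<^sub>C x \<in> closure S" .
qed

lemma closed_orthogonal_to: "closed {z. cinner z w = 0}"
  by (intro closed_Collect_eq continuous_cinner_left continuous_on_const)

section \<open>Orthogonal projections\<close>

text \<open>
  The classical argument: a sequence minimizing the distance to \<open>x\<close> is Cauchy by the
  parallelogram law, and its limit is the foot of the perpendicular.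
\<close>

lemma projection_exists:
  fixes N :: "'a::{real_inner, complete_space} set"
  assumes sub: "subspace N" and cl: "closed N"
  obtains y where "y \<in> N" "\<And>z. z \<in> N \<Longrightarrow> inner (x - y) z = 0"
proof -
  have ne: "N \<noteq> {}" using subspace_0[OF sub] by auto
  define d where "d = infdist x N"
  have d0: "d \<ge> 0" by (simp add: d_def infdist_nonneg)
  have dle: "d\<^sup>2 \<le> (norm (x - z))\<^sup>2" if "z \<in> N" for z
    using infdist_le[OF that, of x] d0 by (intro power_mono) (auto simp: d_def dist_norm)
  have "\<exists>y\<in>N. (norm (x - y))\<^sup>2 < d\<^sup>2 + 1 / real (Suc n)" for n
  proof -
    have "d < sqrt (d\<^sup>2 + 1 / real (Suc n))" using d0 by (intro real_less_rsqrt) simp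
    hence "Inf (dist x ` N) < sqrt (d\<^sup>2 + 1 / real (Suc n))"
      using infdist_notempty[OF ne, of x] by (simp add: d_def)
    then obtain y where "y \<in> N" "dist x y < sqrt (d\<^sup>2 + 1 / real (Suc n))"
      using cInf_lessD[of "dist x ` N"] ne by auto
    moreover from this have "(norm (x - y))\<^sup>2 < (sqrt (d\<^sup>2 + 1 / real (Suc n)))\<^sup>2"
      by (intro power_strict_mono) (auto simp: dist_norm)
    ultimately show ?thesis by auto
  qed
  then obtain y where y: "\<And>n. y n \<in> N" "\<And>n. (norm (x - y n))\<^sup>2 < d\<^sup>2 + 1 / real (Suc n)"
    by metis
  \<comment> \<open>the midpoint of \<open>y m\<close> and \<open>y n\<close> is again in \<open>N\<close>, hence at distance at least \<open>d\<close>\<close>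
  have par: "(norm (y m - y n))\<^sup>2 < 2 / real (Suc m) + 2 / real (Suc n)" for m n
  proof -
    have "(1/2) *\<^sub>R (y m + y n) \<in> N"
      by (intro subspace_scale subspace_add sub y)
    from dle[OF this] have mid: "d\<^sup>2 \<le> (norm (x - (1/2) *\<^sub>R (y m + y n)))\<^sup>2" .
    have "(norm (y m - y n))\<^sup>2 =
      2 * (norm (x - y m))\<^sup>2 + 2 * (norm (x - y n))\<^sup>2 - 4 * (norm (x - (1/2) *\<^sub>R (y m + y n)))\<^sup>2"
      unfolding power2_norm_eq_inner
      by (simp add: inner_diff inner_add inner_commute algebra_simps)
    also have "\<dots> < 2 / real (Suc m) + 2 / real (Suc n)"
      using mid y(2)[of m] y(2)[of n] by argo
    finally show ?thesis .
  qed
  have "Cauchy y"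
  proof (rule metric_CauchyI)
    fix e :: real assume e: "e > 0"
    obtain M where M: "4 / e\<^sup>2 < real M" using reals_Archimedean2 by blast
    have M0: "0 < real M" using M e by (smt (verit) divide_nonneg_nonneg zero_le_power2)
    have "dist (y m) (y n) < e" if "m \<ge> M" "n \<ge> M" for m n
    proof -
      have "2 / real (Suc m) + 2 / real (Suc n) \<le> 2 / real M + 2 / real M"
        using that M0 by (intro add_mono divide_left_mono) auto
      also have "\<dots> < e\<^sup>2" using M M0 e by (simp add: field_simps)
      finally have "(norm (y m - y n))\<^sup>2 < e\<^sup>2" using par[of m n] by linarith
      thus ?thesis using e by (simp add: dist_norm power2_less_imp_less)
    qed
    thus "\<exists>M. \<forall>m\<ge>M. \<forall>n\<ge>M. dist (y m) (y n) < e" by blast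
  qed
  then obtain p where p: "y \<longlonglongrightarrow> p" using Cauchy_convergent convergent_def by blast
  have pN: "p \<in> N" using closed_sequentially[OF cl] y(1) p by blast
  have "(\<lambda>n. (norm (x - y n))\<^sup>2) \<longlonglongrightarrow> (norm (x - p))\<^sup>2" by (intro tendsto_intros p)
  moreover have "(\<lambda>n. d\<^sup>2 + 1 / real (Suc n)) \<longlonglongrightarrow> d\<^sup>2 + 0"
    by (intro tendsto_add tendsto_const LIMSEQ_inverse_real_of_nat[unfolded inverse_eq_divide])
  ultimately have pd: "(norm (x - p))\<^sup>2 \<le> d\<^sup>2"
    using y(2) by (auto intro: LIMSEQ_le less_imp_le)
  have "inner (x - p) z = 0" if z: "z \<in> N" for z
  proof (cases "z = 0")
    case False
    \<comment> \<open>\<open>p + t z\<close> is the point closest to \<open>x\<close> on the line through \<open>p\<close> in direction \<open>z\<close>\<close>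
    define t where "t = inner (x - p) z / (norm z)\<^sup>2"
    have "p + t *\<^sub>R z \<in> N" by (intro subspace_add subspace_scale sub pN z)
    from order_trans[OF pd dle[OF this]]
    have "(norm (x - p))\<^sup>2 \<le> (norm (x - (p + t *\<^sub>R z)))\<^sup>2" .
    also have "\<dots> = (norm (x - p))\<^sup>2 - 2 * t * inner (x - p) z + t\<^sup>2 * (norm z)\<^sup>2"
      unfolding power2_norm_eq_inner
      by (simp add: inner_diff inner_add inner_commute power2_eq_square algebra_simps)
    also have "\<dots> = (norm (x - p))\<^sup>2 - (inner (x - p) z)\<^sup>2 / (norm z)\<^sup>2"
      using False by (simp add: t_def field_simps power2_eq_square)
    finally have "(inner (x - p) z)\<^sup>2 / (norm z)\<^sup>2 \<le> 0" by simp
    thus ?thesis using False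
      by (smt (verit) divide_pos_pos zero_less_power2 norm_eq_zero)
  qed simp
  thus ?thesis using that pN by blast
qed

lemma orth_proj_eqI:
  assumes N: "csubspace N" and y: "y \<in> N" "\<And>z. z \<in> N \<Longrightarrow> cinner (x - y) z = 0"
  shows "orth_proj N x = y"
  unfolding orth_proj_def
proof (rule the_equality)
  fix w assume w: "w \<in> N \<and> (\<forall>z\<in>N. cinner (x - w) z = 0)"
  have "y + (-1::complex) *\<^sub>C w \<in> N" using N y w unfolding csubspace_def by blast
  hence mem: "y - w \<in> N" by (simp add: scaleC_minus_one)
  have "cinner (y - w) (y - w) = cinner (x - w) (y - w) - cinner (x - y) (y - w)"
    by (simp add: cinner_diff_left)
  also have "\<dots> = 0" using mem y(2) w by simp
  finally show "w = y" by (simp add: cinner_self)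
qed (use y in blast)

lemma
  assumes N: "csubspace N" "closed N"
  shows orth_proj_in: "orth_proj N x \<in> N"
    and orth_proj_orthogonal: "z \<in> N \<Longrightarrow> cinner (x - orth_proj N x) z = 0"
proof -
  obtain y where y: "y \<in> N" "\<And>z. z \<in> N \<Longrightarrow> inner (x - y) z = 0"
    using projection_exists[OF csubspace_imp_subspace[OF N(1)] N(2), of x] by blast
  have "orth_proj N x = y"
    by (rule orth_proj_eqI[OF N(1) y(1)]) (rule csubspace_orthogonalI[OF N(1) y(2)])
  with y csubspace_orthogonalI[OF N(1) y(2)]
  show "orth_proj N x \<in> N" "z \<in> N \<Longrightarrow> cinner (x - orth_proj N x) z = 0" by auto
qed

lemma cinner_orth_proj:
  assumes "csubspace N" "closed N" "z \<in> N"
  shows "cinner (orth_proj N x) z = cinner x z" "cinner z (orth_proj N x) = cinner z x"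
proof -
  show eq: "cinner (orth_proj N x) z = cinner x z"
    using orth_proj_orthogonal[OF assms, of x] by (simp add: cinner_diff_left)
  show "cinner z (orth_proj N x) = cinner z x"
    using arg_cong[OF eq, of cnj] by (simp flip: cinner_commute)
qed

lemma norm_orth_proj_le:
  assumes "csubspace N" "closed N"
  shows "norm (orth_proj N x) \<le> norm x"
proof -
  let ?p = "orth_proj N x"
  have "complex_of_real ((norm ?p)\<^sup>2) = cinner x ?p"
    using cinner_orth_proj(1)[OF assms orth_proj_in[OF assms, of x], of x]
    by (simp only: cinner_self)
  hence "(norm ?p)\<^sup>2 = norm (cinner x ?p)" by (metis norm_of_real abs_power2)
  also have "\<dots> \<le> norm x * norm ?p" by (rule cinner_Cauchy_Schwarz)
  finally show ?thesis by (cases "norm ?p = 0") (auto simp: power2_eq_square)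
qed

section \<open>Adjoints\<close>

text \<open>
  If \<open>f\<close> is nonzero, a vector \<open>v\<close> orthogonal to its kernel spans the orthogonal complement, and a
  multiple of it represents \<open>f\<close>.
\<close>

lemma Riesz_representation:
  fixes f :: "'a::{real_inner, complete_space} \<Rightarrow> real"
  assumes "bounded_linear f"
  obtains b where "\<And>x. f x = inner x b"
proof (cases "\<forall>x. f x = 0")
  case True
  thus ?thesis using that[of 0] by simp
next
  case False
  then obtain x where x: "f x \<noteq> 0" by auto
  interpret f: bounded_linear f by fact
  define N where "N = {z. f z = 0}"
  have "subspace N" by (auto simp: N_def subspace_def f.zero f.add f.scaleR)
  moreover have "closed N" unfolding N_def
    by (intro closed_Collect_eq linear_continuous_on assms continuous_on_const)
  ultimately obtain y where y: "y \<in> N" "\<And>z. z \<in> N \<Longrightarrow> inner (x - y) z = 0"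
    using projection_exists[of N x] by blast
  define v where "v = x - y"
  have fv: "f v \<noteq> 0" using x y by (simp add: v_def N_def f.diff)
  hence v0: "v \<noteq> 0" by (auto simp: f.zero)
  have "f z = inner z ((f v / (norm v)\<^sup>2) *\<^sub>R v)" for z
  proof -
    have "z - (f z / f v) *\<^sub>R v \<in> N" using fv by (simp add: N_def f.diff f.scaleR)
    from y(2)[OF this] have "inner z v = f z / f v * (norm v)\<^sup>2"
      by (simp add: v_def[symmetric] inner_diff inner_commute power2_norm_eq_inner)
    thus ?thesis using fv v0 by simp
  qed
  thus ?thesis using that by blast
qed

text \<open>
  The representing vector for the real part works for the whole functional: the imaginary part at
  \<open>x\<close> is, up to sign, the real part at \<open>\<i> *\<^sub>C x\<close>.
\<close>

lemma adjoint_exists: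
  assumes A: "A \<in> bounded_ops"
  obtains b where "\<And>x. cinner (A x) y = cinner x b"
proof -
  have blA: "bounded_linear A" and AC: "\<And>c x. A (c *\<^sub>C x) = c *\<^sub>C A x"
    using A by (auto simp: bounded_ops_def)
  obtain b where b: "\<And>x. inner (A x) y = inner x b"
    using Riesz_representation[OF bounded_linear_compose[OF bounded_linear_inner_left blA], of y]
    by blast
  have "cinner (A x) y = cinner x b" for x
  proof (rule complex_eqI)
    show "Re (cinner (A x) y) = Re (cinner x b)"
      using b[of x] by (simp add: inner_eq_Re_cinner)
    show "Im (cinner (A x) y) = Im (cinner x b)"
      using b[of "\<i> *\<^sub>C x"] by (simp add: inner_eq_Re_cinner AC cinner_scaleC_left)
  qed
  thus ?thesis using that by blast
qed

lemma cinner_hilbert_adjoint: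
  assumes A: "A \<in> bounded_ops"
  shows "cinner (A x) y = cinner x (hilbert_adjoint A y)"
proof -
  have "\<forall>y. \<exists>b. \<forall>x. cinner (A x) y = cinner x b"
  proof
    fix y
    show "\<exists>b. \<forall>x. cinner (A x) y = cinner x b"
      by (rule adjoint_exists[OF A, of y]) (intro exI allI)
  qed
  from choice[OF this] obtain B where B: "\<And>x y. cinner (A x) y = cinner x (B y)"
    by (elim exE) simp
  have "hilbert_adjoint A = B" unfolding hilbert_adjoint_def
  proof (rule the_equality)
    fix C assume C: "\<forall>x y. cinner (A x) y = cinner x (C y)"
    have "cinner (C y) x = cinner (B y) x" for x y
    proof -
      have "cinner x (C y) = cinner x (B y)" using B[of x y] C[rule_format, of x y] by (simp only:)
      thus ?thesis by (subst (1 2) cinner_commute) simp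
    qed
    thus "C = B" by (auto intro: cinner_eqI)
  qed (use B in blast)
  thus ?thesis using B[of x y] by (simp only:)
qed

section \<open>The Hahn-Banach theorem\<close>

definition sublinear :: "('a::real_vector \<Rightarrow> real) \<Rightarrow> bool" where
  "sublinear p \<longleftrightarrow> (\<forall>x y. p (x + y) \<le> p x + p y) \<and> (\<forall>c\<ge>0. \<forall>x. p (c *\<^sub>R x) = c * p x)"

lemma sublinear_add: "sublinear p \<Longrightarrow> p (x + y) \<le> p x + p y"
  and sublinear_scaleR: "sublinear p \<Longrightarrow> c \<ge> 0 \<Longrightarrow> p (c *\<^sub>R x) = c * p x"
  by (auto simp: sublinear_def)

lemma sublinear_zero: "sublinear p \<Longrightarrow> p 0 = 0"
  using sublinear_scaleR[of p 0 0] by simp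

lemma sublinear_minus: "sublinear p \<Longrightarrow> - p (- x) \<le> p x"
  using sublinear_add[of p x "- x"] by (simp add: sublinear_zero)

lemma sublinearI:
  assumes zero: "p 0 = 0" and add: "\<And>x y. p (x + y) \<le> p x + p y"
    and scale: "\<And>c x. c > 0 \<Longrightarrow> p (c *\<^sub>R x) \<le> c * p x"
  shows "sublinear p"
proof -
  have "p (c *\<^sub>R x) = c * p x" if "c \<ge> 0" for c x
  proof (cases "c = 0")
    case False
    with that have c: "c > 0" by simp
    have "p x \<le> inverse c * p (c *\<^sub>R x)" using scale[of "inverse c" "c *\<^sub>R x"] c by simp
    hence "c * p x \<le> p (c *\<^sub>R x)" using c by (simp add: field_simps)
    with scale[OF c] show ?thesis by (intro antisym)
  qed (simp add: zero)
  thus ?thesis using add by (auto simp: sublinear_def)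
qed

text \<open>
  The largest sublinear minorant of \<open>p\<close> that takes the value \<open>- p y\<close> at \<open>- y\<close>.  A sublinear
  functional with no smaller sublinear one below it agrees with all its tilts, and this makes
  it additive.
\<close>

definition tilt :: "('a::real_vector \<Rightarrow> real) \<Rightarrow> 'a \<Rightarrow> 'a \<Rightarrow> real" where
  "tilt p y x = (INF t\<in>{0..}. p (x + t *\<^sub>R y) - t * p y)"

lemma tilt_lower_bound:
  assumes p: "sublinear p" and t: "t \<ge> 0"
  shows "- p (- x) \<le> p (x + t *\<^sub>R y) - t * p y"
  using sublinear_add[OF p, of "x + t *\<^sub>R y" "- x"] sublinear_scaleR[OF p t, of y] by simp

lemma tilt_le:
  assumes "sublinear p" "t \<ge> 0"
  shows "tilt p y x \<le> p (x + t *\<^sub>R y) - t * p y"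
  unfolding tilt_def
  by (rule cINF_lower) (use assms tilt_lower_bound in \<open>auto intro!: bdd_belowI2\<close>)

lemma tilt_greatest:
  assumes "\<And>t. t \<ge> 0 \<Longrightarrow> m \<le> p (x + t *\<^sub>R y) - t * p y"
  shows "m \<le> tilt p y x"
  unfolding tilt_def by (rule cINF_greatest) (use assms in auto)

lemma tilt_le_self: "sublinear p \<Longrightarrow> tilt p y x \<le> p x"
  using tilt_le[of p 0 y x] by simp

lemma tilt_minus: "sublinear p \<Longrightarrow> tilt p y (- y) \<le> - p y"
  using tilt_le[of p 1 y "- y"] by (simp add: sublinear_zero)

lemma sublinear_tilt:
  assumes p: "sublinear p"
  shows "sublinear (tilt p y)"
proof (rule sublinearI)
  show "tilt p y 0 = 0"
  proof (rule antisym)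
    show "tilt p y 0 \<le> 0" using tilt_le_self[OF p, of y 0] by (simp add: sublinear_zero p)
    show "0 \<le> tilt p y 0" by (rule tilt_greatest) (simp add: sublinear_scaleR[OF p])
  qed
next
  fix x x'
  have *: "tilt p y (x + x') \<le> (p (x + s *\<^sub>R y) - s * p y) + (p (x' + t *\<^sub>R y) - t * p y)"
    if "s \<ge> 0" "t \<ge> 0" for s t
  proof -
    have "tilt p y (x + x') \<le> p ((x + s *\<^sub>R y) + (x' + t *\<^sub>R y)) - (s + t) * p y"
      using tilt_le[OF p, of "s + t" y "x + x'"] that by (simp add: algebra_simps)
    also have "\<dots> \<le> (p (x + s *\<^sub>R y) - s * p y) + (p (x' + t *\<^sub>R y) - t * p y)"
      using sublinear_add[OF p, of "x + s *\<^sub>R y" "x' + t *\<^sub>R y"] by (simp add: algebra_simps)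
    finally show ?thesis .
  qed
  have "tilt p y (x + x') - (p (x' + t *\<^sub>R y) - t * p y) \<le> tilt p y x" if "t \<ge> 0" for t
    by (rule tilt_greatest) (use *[OF _ that] in \<open>simp add: algebra_simps\<close>)
  hence "tilt p y (x + x') - tilt p y x \<le> tilt p y x'"
    by (intro tilt_greatest) (simp add: algebra_simps)
  thus "tilt p y (x + x') \<le> tilt p y x + tilt p y x'" by simp
next
  fix c :: real and x :: 'a assume c: "c > 0"
  have "tilt p y (c *\<^sub>R x) / c \<le> tilt p y x"
  proof (rule tilt_greatest)
    fix t :: real assume t: "t \<ge> 0"
    have "tilt p y (c *\<^sub>R x) \<le> p (c *\<^sub>R (x + t *\<^sub>R y)) - (c * t) * p y"
      using tilt_le[OF p, of "c * t" y "c *\<^sub>R x"] c t by (simp add: scaleR_add_right)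
    also have "\<dots> = c * (p (x + t *\<^sub>R y) - t * p y)"
      using sublinear_scaleR[OF p, of c "x + t *\<^sub>R y"] c by (simp add: algebra_simps)
    finally show "tilt p y (c *\<^sub>R x) / c \<le> p (x + t *\<^sub>R y) - t * p y"
      using c by (simp add: field_simps)
  qed
  thus "tilt p y (c *\<^sub>R x) \<le> c * tilt p y x" using c by (simp add: field_simps)
qed

text \<open>
  Zorn's lemma provides a minimal sublinear functional below \<open>p\<close>; chains are bounded by
  their pointwise infima, which are finite because \<open>\<lambda>x. - p (- x)\<close> lies below each member.
\<close>

lemma minimal_sublinear_exists:
  fixes p :: "'a::real_vector \<Rightarrow> real"
  assumes p: "sublinear p"
  obtains q where "sublinear q" "q \<le> p" "\<And>r. sublinear r \<Longrightarrow> r \<le> q \<Longrightarrow> r = q"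
proof -
  define A where "A = {q. sublinear q \<and> q \<le> p}"
  have "\<exists>m\<in>A. \<forall>a\<in>A. a \<le> m \<longrightarrow> a = m"
  proof (rule predicate_Zorn)
    show "partial_order_on A (relation_of (\<lambda>a b. b \<le> a) A)"
      by (rule partial_order_on_relation_ofI) auto
  next
    fix C assume C: "C \<in> Chains (relation_of (\<lambda>a b. b \<le> a) A)"
    hence CA: "C \<subseteq> A" by (rule Chains_relation_of)
    have tot: "q \<le> r \<or> r \<le> q" if "q \<in> C" "r \<in> C" for q r
      using C that by (auto simp: Chains_def relation_of_def)
    show "\<exists>u\<in>A. \<forall>a\<in>C. u \<le> a"
    proof (cases "C = {}")
      case True
      thus ?thesis using p by (auto simp: A_def)
    next
      case ne: False
      define u where "u x = (INF q\<in>C. q x)" for x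
      have low: "- p (- x) \<le> q x" if "q \<in> C" for q x
      proof -
        have "sublinear q" "q (- x) \<le> p (- x)" using CA that by (auto simp: A_def le_fun_def)
        thus ?thesis using sublinear_minus[of q x] by simp
      qed
      have ule: "u x \<le> q x" if "q \<in> C" for q x
        unfolding u_def by (rule cINF_lower) (use that low in \<open>auto intro!: bdd_belowI2\<close>)
      have ugr: "m \<le> u x" if "\<And>q. q \<in> C \<Longrightarrow> m \<le> q x" for m x
        unfolding u_def by (rule cINF_greatest) (use that ne in auto)
      have "sublinear u"
      proof (rule sublinearI)
        have "q 0 = 0" if "q \<in> C" for q
          using CA that by (intro sublinear_zero) (auto simp: A_def)
        hence "(\<lambda>q. q 0) ` C = {0}" using ne by force
        thus "u 0 = 0" by (simp add: u_def)
      next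
        fix x y
        have *: "u (x + y) \<le> q x + r y" if qr: "q \<in> C" "r \<in> C" for q r
        proof -
          obtain s where s: "s \<in> C" "s \<le> q" "s \<le> r" using tot[OF qr] qr by blast
          have "u (x + y) \<le> s (x + y)" by (rule ule[OF s(1)])
          also have "\<dots> \<le> s x + s y" using CA s(1) by (auto simp: A_def sublinear_def)
          also have "\<dots> \<le> q x + r y" using s by (intro add_mono) (auto simp: le_fun_def)
          finally show ?thesis .
        qed
        have "u (x + y) - r y \<le> u x" if "r \<in> C" for r
          by (rule ugr) (use *[OF _ that] in \<open>simp add: algebra_simps\<close>)
        hence "u (x + y) - u x \<le> u y" by (intro ugr) (simp add: algebra_simps)
        thus "u (x + y) \<le> u x + u y" by simp
      next
        fix c :: real and x :: 'a assume c: "c > 0"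
        have "u (c *\<^sub>R x) / c \<le> u x"
        proof (rule ugr)
          fix q assume q: "q \<in> C"
          have "u (c *\<^sub>R x) \<le> q (c *\<^sub>R x)" by (rule ule[OF q])
          also have "\<dots> = c * q x" using CA q c by (auto simp: A_def sublinear_def)
          finally show "u (c *\<^sub>R x) / c \<le> q x" using c by (simp add: field_simps)
        qed
        thus "u (c *\<^sub>R x) \<le> c * u x" using c by (simp add: field_simps)
      qed
      moreover have "u \<le> p"
      proof (rule le_funI)
        fix x
        obtain q where q: "q \<in> C" using ne by blast
        hence "q x \<le> p x" using CA by (auto simp: A_def le_fun_def)
        with ule[OF q] show "u x \<le> p x" by (rule order_trans)
      qed
      ultimately show ?thesis using ule by (auto simp: A_def le_fun_def)
    qed
  qed
  then obtain m where m: "m \<in> A" "\<And>a. a \<in> A \<Longrightarrow> a \<le> m \<Longrightarrow> a = m" by blast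
  show ?thesis
    by (rule that[of m]) (use m in \<open>auto simp: A_def intro: order_trans\<close>)
qed

text \<open>
  Each tilt of a minimal \<open>q\<close> is a sublinear functional below \<open>q\<close>, hence equal to \<open>q\<close>. The tilt in
  direction \<open>y\<close>, estimated with parameter one, then gives superadditivity.
\<close>

lemma linear_minorant_exists:
  fixes p :: "'a::real_vector \<Rightarrow> real"
  assumes p: "sublinear p"
  obtains \<phi> where "linear \<phi>" "\<And>x. \<phi> x \<le> p x"
proof -
  obtain q where q: "sublinear q" "q \<le> p" "\<And>r. sublinear r \<Longrightarrow> r \<le> q \<Longrightarrow> r = q"
    using minimal_sublinear_exists[OF p] by blast
  have tilt_q: "tilt q y = q" for y
    by (rule q(3)[OF sublinear_tilt[OF q(1)]]) (simp add: le_fun_def tilt_le_self q(1))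
  have add: "q (x + y) = q x + q y" for x y
  proof (rule antisym)
    show "q (x + y) \<le> q x + q y" by (rule sublinear_add[OF q(1)])
    show "q x + q y \<le> q (x + y)" using tilt_le[OF q(1), of 1 y x] by (simp add: tilt_q)
  qed
  have minus: "q (- x) = - q x" for x
    using add[of x "- x"] by (simp add: sublinear_zero q(1))
  have "q (c *\<^sub>R x) = c * q x" for c x
  proof (cases "c \<ge> 0")
    case False
    hence "q (c *\<^sub>R x) = - q ((- c) *\<^sub>R x)" using minus[of "c *\<^sub>R x"] by simp
    also have "\<dots> = c * q x" using False by (subst sublinear_scaleR[OF q(1)]) auto
    finally show ?thesis .
  qed (simp add: sublinear_scaleR[OF q(1)])
  hence "linear q" by (intro linearI) (simp_all add: add)
  thus ?thesis using that[of q] q(2) by (auto simp: le_fun_def)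
qed

text \<open>Tilting \<open>p\<close> at \<open>z\<close> first forces the linear minorant to touch \<open>p\<close> there.\<close>

lemma Hahn_Banach_support:
  fixes p :: "'a::real_vector \<Rightarrow> real"
  assumes p: "sublinear p"
  obtains \<phi> where "linear \<phi>" "\<And>x. \<phi> x \<le> p x" "\<phi> z = p z"
proof -
  obtain \<phi> where \<phi>: "linear \<phi>" "\<And>x. \<phi> x \<le> tilt p z x"
    using linear_minorant_exists[OF sublinear_tilt[OF p]] by blast
  have le: "\<phi> x \<le> p x" for x using \<phi>(2)[of x] tilt_le_self[OF p, of z x] by simp
  have "- \<phi> z \<le> - p z"
    using \<phi>(2)[of "- z"] tilt_minus[OF p, of z] by (simp add: linear_neg[OF \<phi>(1)])
  with le[of z] show ?thesis using that[OF \<phi>(1) le] by simp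
qed

lemma sublinear_infdist:
  fixes J :: "'a::real_normed_vector set"
  assumes J: "subspace J"
  shows "sublinear (\<lambda>x. infdist x J)"
proof (rule sublinearI)
  have ne: "J \<noteq> {}" using subspace_0[OF J] by auto
  have gr: "m \<le> infdist x J" if "\<And>a. a \<in> J \<Longrightarrow> m \<le> norm (x - a)" for m x
    using ne that by (auto simp: infdist_notempty dist_norm intro!: cINF_greatest)
  show "infdist 0 J = 0" using subspace_0[OF J] by (rule infdist_zero)
  fix x y :: 'a
  have *: "infdist (x + y) J \<le> norm (x - a) + norm (y - b)" if "a \<in> J" "b \<in> J" for a b
  proof -
    have "infdist (x + y) J \<le> norm ((x - a) + (y - b))"
      using infdist_le[OF subspace_add[OF J that], of "x + y"]
      by (simp add: dist_norm algebra_simps)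
    also have "\<dots> \<le> norm (x - a) + norm (y - b)" by (rule norm_triangle_ineq)
    finally show ?thesis .
  qed
  have "infdist (x + y) J - norm (y - b) \<le> infdist x J" if "b \<in> J" for b
    by (rule gr) (use *[OF _ that] in \<open>simp add: algebra_simps\<close>)
  hence "infdist (x + y) J - infdist x J \<le> infdist y J"
    by (intro gr) (simp add: algebra_simps)
  thus "infdist (x + y) J \<le> infdist x J + infdist y J" by simp
  fix c :: real assume c: "c > 0"
  have "infdist (c *\<^sub>R x) J / c \<le> infdist x J"
  proof (rule gr)
    fix a assume "a \<in> J"
    hence "infdist (c *\<^sub>R x) J \<le> norm (c *\<^sub>R x - c *\<^sub>R a)"
      using infdist_le[OF subspace_scale[OF J]] by (metis dist_norm)
    also have "\<dots> = c * norm (x - a)"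
      using c by (simp flip: scaleR_diff_right)
    finally show "infdist (c *\<^sub>R x) J / c \<le> norm (x - a)" using c by (simp add: field_simps)
  qed
  thus "infdist (c *\<^sub>R x) J \<le> c * infdist x J" using c by (simp add: field_simps)
qed

text \<open>
  Domination by the distance contains both conclusions at once: the distance is below the norm, and
  it is zero on \<open>J\<close>, where linearity turns the upper bound for \<open>\<plusminus>x\<close> into equality.
\<close>

lemma Hahn_Banach_infdist:
  fixes J :: "'a::real_normed_vector set"
  assumes J: "subspace J"
  obtains \<phi> where "linear \<phi>" "\<And>x. \<phi> x \<le> norm x" "\<And>x. x \<in> J \<Longrightarrow> \<phi> x = 0"
    "\<phi> z = infdist z J"
proof -
  obtain \<phi> where \<phi>: "linear \<phi>" "\<And>x. \<phi> x \<le> infdist x J" "\<phi> z = infdist z J"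
    using Hahn_Banach_support[OF sublinear_infdist[OF J], of z] by blast
  show ?thesis
  proof (rule that[OF \<phi>(1) _ _ \<phi>(3)])
    show "\<phi> x \<le> norm x" for x
      using \<phi>(2)[of x] infdist_le[OF subspace_0[OF J], of x] by simp
    show "\<phi> x = 0" if "x \<in> J" for x
      using \<phi>(2)[of x] \<phi>(2)[of "- x"] infdist_zero[OF that] infdist_zero[OF subspace_neg[OF J that]]
      by (simp add: linear_neg[OF \<phi>(1)])
  qed
qed

section \<open>The weak-star topology\<close>

text \<open>
  The rank-one operators belong to the predual: all terms of the series after the first are zero.
\<close>

lemma vector_state_in_predual: "(\<lambda>A. cinner (A x) y) \<in> predual_functionals"
proof -
  define X where "X n = (if n = 0 then x else 0)" for n :: nat
  define Y where "Y n = (if n = 0 then y else 0)" for n :: nat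
  have "(\<lambda>A. cinner (A x) y) = (\<lambda>A. \<Sum>n. cinner (A (X n)) (Y n))"
  proof
    fix A
    have "(\<Sum>n. cinner (A (X n)) (Y n)) = (\<Sum>n\<in>{0}. cinner (A (X n)) (Y n))"
      by (rule suminf_finite) (auto simp: Y_def)
    thus "cinner (A x) y = (\<Sum>n. cinner (A (X n)) (Y n))" by (simp add: X_def Y_def)
  qed
  moreover have "summable (\<lambda>n. (norm (X n))\<^sup>2)" "summable (\<lambda>n. (norm (Y n))\<^sup>2)"
    by (rule summable_finite[of "{0}"]; simp add: X_def Y_def)+
  ultimately show ?thesis unfolding predual_functionals_def by blast
qed

lemma topspace_weak_star: "topspace weak_star_topology = bounded_ops"
proof -
  have "(\<lambda>A. cinner (A 0) 0) \<in> predual_functionals"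
    by (rule vector_state_in_predual)
  hence "bounded_ops \<subseteq> topspace (weak_star_topology :: ('a \<Rightarrow> 'a) topology)"
    unfolding weak_star_topology_def topology_generated_by_topspace
    by (intro Union_upper CollectI exI[of _ UNIV] exI conjI) auto
  thus ?thesis
    unfolding weak_star_topology_def topology_generated_by_topspace by auto
qed

lemma continuous_map_predual:
  assumes "\<omega> \<in> predual_functionals"
  shows "continuous_map weak_star_topology euclidean \<omega>"
  unfolding continuous_map_def topspace_weak_star
proof (intro conjI allI impI)
  fix U :: "complex set" assume "openin euclidean U"
  thus "openin weak_star_topology {A \<in> bounded_ops. \<omega> A \<in> U}"
    unfolding weak_star_topology_def using assms
    by (intro topology_generated_by_Basis) auto
qed auto

section \<open>Algebras of multipliers\<close>

locale multiplier_algebra =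
  fixes ev :: "'h::complex_hilbert \<Rightarrow> 'x \<Rightarrow> complex"
    and k :: "'x \<Rightarrow> 'h"
    and \<AA> :: "('x \<Rightarrow> complex) set"
  assumes rkhs: "rkhs ev k" and dual: "dual_algebra ev \<AA>"
begin

abbreviation M :: "('x \<Rightarrow> complex) \<Rightarrow> 'h \<Rightarrow> 'h" where "M \<equiv> mult_op ev"

abbreviation J :: "'x set \<Rightarrow> ('x \<Rightarrow> complex) set" where "J \<equiv> vanishing_ideal \<AA>"

lemma ev_eq: "ev h l = cinner h (k l)"
  using rkhs by (simp add: rkhs_def)

lemma kernel_nonzero: "k l \<noteq> 0"
  using rkhs by (simp add: rkhs_def)

lemma ev_eqI: "(\<And>l. ev a l = ev b l) \<Longrightarrow> a = b"
  using rkhs unfolding rkhs_def by (metis ext injD)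

lemma one_in: "(\<lambda>x. 1) \<in> \<AA>"
  and add_in: "f \<in> \<AA> \<Longrightarrow> g \<in> \<AA> \<Longrightarrow> (\<lambda>x. f x + g x) \<in> \<AA>"
  and mult_in: "f \<in> \<AA> \<Longrightarrow> g \<in> \<AA> \<Longrightarrow> (\<lambda>x. f x * g x) \<in> \<AA>"
  and scale_in: "f \<in> \<AA> \<Longrightarrow> (\<lambda>x. c * f x) \<in> \<AA>"
  using dual by (auto simp: dual_algebra_def)

lemma zero_in: "(\<lambda>x. 0) \<in> \<AA>"
  using scale_in[OF one_in, of 0] by simp

lemma ev_M:
  assumes "f \<in> \<AA>"
  shows "ev (M f h) l = f l * ev h l"
proof -
  have "(\<lambda>x. f x * ev h x) \<in> range ev"
    using assms dual by (auto simp: dual_algebra_def multipliers_def)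
  hence "ev (M f h) = (\<lambda>x. f x * ev h x)"
    unfolding mult_op_def by (rule f_inv_into_f)
  thus ?thesis by simp
qed

lemma M_one: "M (\<lambda>x. 1) h = h"
  by (rule ev_eqI) (simp add: ev_M one_in)

lemma M_zero: "M (\<lambda>x. 0) h = 0"
  by (rule ev_eqI) (simp add: ev_M zero_in, simp add: ev_eq)

lemma M_add: "f \<in> \<AA> \<Longrightarrow> g \<in> \<AA> \<Longrightarrow> M (\<lambda>x. f x + g x) h = M f h + M g h"
  by (rule ev_eqI) (use ev_M in \<open>simp add: add_in ev_eq cinner_add_left algebra_simps\<close>)

lemma M_mult: "f \<in> \<AA> \<Longrightarrow> g \<in> \<AA> \<Longrightarrow> M (\<lambda>x. f x * g x) h = M f (M g h)"
  by (rule ev_eqI) (simp add: ev_M mult_in)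

lemma M_scale: "f \<in> \<AA> \<Longrightarrow> M (\<lambda>x. c * f x) h = c *\<^sub>C M f h"
  by (rule ev_eqI) (use ev_M in \<open>simp add: scale_in ev_eq cinner_scaleC_left algebra_simps\<close>)

lemma M_bounded_op: "f \<in> \<AA> \<Longrightarrow> M f \<in> bounded_ops"
  using dual closedin_subset topspace_weak_star unfolding dual_algebra_def by blast

lemma M_bounded_linear: "f \<in> \<AA> \<Longrightarrow> bounded_linear (M f)"
  using M_bounded_op by (auto simp: bounded_ops_def)

lemma J_subset: "f \<in> J E \<Longrightarrow> f \<in> \<AA>"
  and J_zero: "(\<lambda>x. 0) \<in> J E"
  and J_add: "f \<in> J E \<Longrightarrow> g \<in> J E \<Longrightarrow> (\<lambda>x. f x + g x) \<in> J E"
  and J_scale: "f \<in> J E \<Longrightarrow> (\<lambda>x. c * f x) \<in> J E"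
  and J_mult: "g \<in> J E \<Longrightarrow> f \<in> \<AA> \<Longrightarrow> (\<lambda>x. g x * f x) \<in> J E"
  by (auto simp: vanishing_ideal_def zero_in add_in scale_in mult_in)

lemma evaluation_eq_state:
  assumes "f \<in> \<AA>"
  shows "f l = cinner (M f (k l)) (k l) / (norm (k l))\<^sup>2"
  using ev_M[OF assms, of "k l" l] kernel_nonzero[of l] by (simp add: ev_eq cinner_self)

text \<open>
  On the algebra the evaluation at \<open>l\<close> is the vector state at the normalized kernel function.
\<close>

lemma weak_star_continuous_evaluations:
  assumes "finite E"
  shows "weak_star_continuous_on ev \<AA> (\<lambda>f. \<Sum>l\<in>E. c l * f l)"
  unfolding weak_star_continuous_on_def
proof (rule continuous_map_sum[OF assms])
  fix l
  let ?T = "pullback_topology \<AA> M weak_star_topology"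
  let ?\<omega> = "\<lambda>A. cinner (A (k l)) (cnj (c l / (norm (k l))\<^sup>2) *\<^sub>C k l)"
  have "continuous_map ?T euclidean (?\<omega> \<circ> M)"
    by (intro continuous_map_pullback continuous_map_predual vector_state_in_predual)
  thus "continuous_map ?T euclidean (\<lambda>f. c l * f l)"
    by (rule continuous_map_eq)
      (simp add: topspace_pullback_topology cinner_scaleC_right evaluation_eq_state[of _ l])
qed

section \<open>Cyclic subspaces and compressions\<close>

lemma cyclic_csubspace: "csubspace (cyclic ev \<AA> h)"
  unfolding cyclic_def
proof (rule csubspace_closure, unfold csubspace_def, intro conjI ballI allI)
  show "0 \<in> (\<lambda>f. M f h) ` \<AA>" by (rule image_eqI[where x="\<lambda>x. 0"]) (simp_all add: M_zero zero_in)
next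
  fix x y assume "x \<in> (\<lambda>f. M f h) ` \<AA>" "y \<in> (\<lambda>f. M f h) ` \<AA>"
  then obtain f g where "f \<in> \<AA>" "g \<in> \<AA>" "x = M f h" "y = M g h" by blast
  thus "x + y \<in> (\<lambda>f. M f h) ` \<AA>"
    by (intro image_eqI[where x="\<lambda>x. f x + g x"]) (simp_all add: M_add add_in)
next
  fix c x assume "x \<in> (\<lambda>f. M f h) ` \<AA>"
  then obtain f where "f \<in> \<AA>" "x = M f h" by blast
  thus "c *\<^sub>C x \<in> (\<lambda>f. M f h) ` \<AA>"
    by (intro image_eqI[where x="\<lambda>x. c * f x"]) (simp_all add: M_scale scale_in)
qed

lemma cyclic_closed: "closed (cyclic ev \<AA> h)"
  by (simp add: cyclic_def)

lemma orbit_in_cyclic: "f \<in> \<AA> \<Longrightarrow> M f h \<in> cyclic ev \<AA> h"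
  unfolding cyclic_def by (rule subsetD[OF closure_subset]) simp

lemma generator_in_cyclic: "h \<in> cyclic ev \<AA> h"
  using orbit_in_cyclic[OF one_in] by (simp add: M_one)

lemma cyclic_induct:
  assumes z: "z \<in> cyclic ev \<AA> h" and cl: "closed {z. P z}"
    and orbit: "\<And>f. f \<in> \<AA> \<Longrightarrow> P (M f h)"
  shows "P z"
proof -
  have "(\<lambda>f. M f h) ` \<AA> \<subseteq> {z. P z}" using orbit by auto
  from closure_minimal[OF this cl] z show ?thesis unfolding cyclic_def by blast
qed

lemma cyclic_invariant:
  assumes f: "f \<in> \<AA>" and z: "z \<in> cyclic ev \<AA> h"
  shows "M f z \<in> cyclic ev \<AA> h"
proof (rule cyclic_induct[OF z])
  show "closed {z. M f z \<in> cyclic ev \<AA> h}"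
    using continuous_closed_vimage[OF cyclic_closed, of "M f" h]
      linear_continuous_at[OF M_bounded_linear[OF f]]
    by (simp add: vimage_def)
  show "M f (M g h) \<in> cyclic ev \<AA> h" if "g \<in> \<AA>" for g
    using orbit_in_cyclic[OF mult_in[OF f that]] by (simp add: M_mult f that)
qed

abbreviation N :: "'x set \<Rightarrow> 'h \<Rightarrow> 'h set" where "N E h \<equiv> NP_space ev \<AA> E (cyclic ev \<AA> h)"

lemma N_iff: "z \<in> N E h \<longleftrightarrow>
    z \<in> cyclic ev \<AA> h \<and> (\<forall>g\<in>J E. \<forall>x\<in>cyclic ev \<AA> h. cinner z (M g x) = 0)"
  by (auto simp: NP_space_def orth_diff_def)

lemma N_csubspace: "csubspace (N E h)"
  using cyclic_csubspace[of h] unfolding csubspace_def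
  by (auto simp: N_iff cinner_add_left cinner_scaleC_left)

lemma N_closed: "closed (N E h)"
proof -
  have "N E h = cyclic ev \<AA> h \<inter> (\<Inter>g\<in>J E. \<Inter>x\<in>cyclic ev \<AA> h. {z. cinner z (M g x) = 0})"
    by (auto simp: N_iff)
  thus ?thesis by (auto intro!: closed_Int closed_INT cyclic_closed closed_orthogonal_to)
qed

abbreviation compression :: "'x set \<Rightarrow> 'h \<Rightarrow> ('x \<Rightarrow> complex) \<Rightarrow> 'h \<Rightarrow> 'h" where
  "compression E h f x \<equiv> orth_proj (N E h) (hilbert_adjoint (M f) x)"

lemma adjoint_M: "f \<in> \<AA> \<Longrightarrow> cinner x (hilbert_adjoint (M f) y) = cinner (M f x) y"
  by (rule cinner_hilbert_adjoint[OF M_bounded_op, symmetric])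

lemma M_diff_bounded_linear:
  "f \<in> \<AA> \<Longrightarrow> g \<in> \<AA> \<Longrightarrow> bounded_linear (\<lambda>h. M f h - M g h)"
  by (intro bounded_linear_sub M_bounded_linear)

text \<open>
  The choice of \<open>g\<close> in the ideal is free because \<open>M g\<close> maps the cyclic subspace into the set to which
  \<open>x\<close> is orthogonal; so \<open>M f\<close> may be replaced by \<open>M f - M g\<close> when it is paired with \<open>x\<close>.
\<close>

lemma norm_compression_le:
  assumes f: "f \<in> \<AA>" and g: "g \<in> J E" and x: "x \<in> N E h"
  shows "norm (compression E h f x) \<le> onorm (\<lambda>h. M f h - M g h) * norm x"
proof -
  let ?w = "compression E h f x" and ?D = "\<lambda>h. M f h - M g h"
  have w: "?w \<in> N E h" by (rule orth_proj_in[OF N_csubspace N_closed])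
  have "cinner x (M g ?w) = 0" using x w g by (auto simp: N_iff)
  hence 0: "cinner (M g ?w) x = 0" by (subst cinner_commute) simp
  have "complex_of_real ((norm ?w)\<^sup>2) = cinner ?w ?w" by (simp only: cinner_self)
  also have "\<dots> = cinner ?w (hilbert_adjoint (M f) x)"
    by (rule cinner_orth_proj(2)[OF N_csubspace N_closed w])
  also have "\<dots> = cinner (?D ?w) x" by (simp add: adjoint_M f cinner_diff_left 0)
  finally have "(norm ?w)\<^sup>2 = norm (cinner (?D ?w) x)" by (metis norm_of_real abs_power2)
  also have "\<dots> \<le> norm (?D ?w) * norm x" by (rule cinner_Cauchy_Schwarz)
  also have "\<dots> \<le> (onorm ?D * norm ?w) * norm x"
    by (intro mult_right_mono onorm M_diff_bounded_linear f J_subset[OF g] norm_ge_zero)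
  finally have "norm ?w * norm ?w \<le> (onorm ?D * norm x) * norm ?w"
    by (simp add: power2_eq_square algebra_simps)
  moreover have "0 \<le> onorm ?D * norm x"
    by (intro mult_nonneg_nonneg onorm_pos_le M_diff_bounded_linear f J_subset[OF g] norm_ge_zero)
  ultimately show ?thesis
    by (cases "norm ?w = 0") (auto simp: mult_le_cancel_right)
qed

lemma norm_compression_le_onorm:
  assumes f: "f \<in> \<AA>" and g: "g \<in> J E" and x: "x \<in> N E h" "norm x \<le> 1"
  shows "norm (compression E h f x) \<le> onorm (\<lambda>h. M f h - M g h)"
  by (rule order_trans[OF norm_compression_le[OF f g x(1)]
        mult_left_le[OF x(2) onorm_pos_le[OF M_diff_bounded_linear[OF f J_subset[OF g]]]]])

abbreviation compression_norm :: "'x set \<Rightarrow> 'h \<Rightarrow> ('x \<Rightarrow> complex) \<Rightarrow> real" where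
  "compression_norm E h f \<equiv> restr_norm (N E h) (compression E h f)"

lemma norm_compression_le_compression_norm:
  assumes f: "f \<in> \<AA>" and x: "x \<in> N E h" "norm x \<le> 1"
  shows "norm (compression E h f x) \<le> compression_norm E h f"
  unfolding restr_norm_def
proof (rule cSUP_upper)
  show "bdd_above ((\<lambda>x. norm (compression E h f x)) ` {x \<in> N E h. norm x \<le> 1})"
    using norm_compression_le_onorm[OF f J_zero] by (intro bdd_aboveI2) blast
qed (use x in simp)

lemma compression_norm_nonneg:
  assumes f: "f \<in> \<AA>"
  shows "0 \<le> compression_norm E h f"
proof -
  have "0 \<in> N E h" using N_csubspace by (auto simp: csubspace_def)
  hence "norm (compression E h f 0) \<le> compression_norm E h f"
    by (rule norm_compression_le_compression_norm[OF f]) simp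
  thus ?thesis by (rule order_trans[OF norm_ge_zero])
qed

lemma compression_norm_le_onorm:
  assumes f: "f \<in> \<AA>" and g: "g \<in> J E"
  shows "compression_norm E h f \<le> onorm (\<lambda>h. M f h - M g h)"
  unfolding restr_norm_def
proof (rule cSUP_least)
  have "0 \<in> N E h" using N_csubspace by (auto simp: csubspace_def)
  thus "{x \<in> N E h. norm x \<le> 1} \<noteq> {}" by auto
qed (use norm_compression_le_onorm[OF f g] in auto)

lemma compression_norm_le_mult_dist:
  assumes f: "f \<in> \<AA>"
  shows "compression_norm E h f \<le> mult_dist ev f (J E)"
  unfolding mult_dist_def
  by (rule cINF_greatest) (use J_zero[of E] compression_norm_le_onorm[OF f] in blast)+

text \<open>
  The adjoint of \<open>M f\<close>, projected back to the cyclic subspace \<open>L\<close>, leaves \<open>N\<close> invariant: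
  for \<open>g\<close> in the ideal, pairing with \<open>M g z\<close> moves \<open>f\<close> to the other side, and \<open>g f\<close> is in the ideal.
\<close>

lemma compression_eq_orth_proj_cyclic:
  assumes f: "f \<in> \<AA>" and u: "u \<in> N E h"
  shows "compression E h f u = orth_proj (cyclic ev \<AA> h) (hilbert_adjoint (M f) u)"
proof (rule orth_proj_eqI[OF N_csubspace])
  let ?L = "cyclic ev \<AA> h"
  let ?v = "hilbert_adjoint (M f) u"
  note L = cyclic_csubspace[of h] cyclic_closed[of h]
  show "orth_proj ?L ?v \<in> N E h" unfolding N_iff
  proof (intro conjI ballI)
    show "orth_proj ?L ?v \<in> ?L" by (rule orth_proj_in[OF L])
    fix g z assume g: "g \<in> J E" and z: "z \<in> ?L"
    have "M g z \<in> ?L" by (rule cyclic_invariant[OF J_subset[OF g] z])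
    hence "cinner (M g z) (orth_proj ?L ?v) = cinner (M g z) ?v"
      by (rule cinner_orth_proj(2)[OF L])
    also have "\<dots> = cinner (M (\<lambda>x. g x * f x) z) u"
      by (simp only: adjoint_M[OF f] M_mult[OF f J_subset[OF g], symmetric] mult.commute)
    also have "\<dots> = cnj (cinner u (M (\<lambda>x. g x * f x) z))" by (rule cinner_commute)
    also have "\<dots> = 0" using u J_mult[OF g f] z by (simp add: N_iff)
    finally show "cinner (orth_proj ?L ?v) (M g z) = 0" by (subst cinner_commute) simp
  qed
  show "cinner (?v - orth_proj ?L ?v) z = 0" if "z \<in> N E h" for z
    using that by (intro orth_proj_orthogonal[OF L]) (simp add: N_iff)
qed

text \<open>
  The generator \<open>x\<close> belongs to its cyclic subspace, so pairing it with the adjoint applied to \<open>y\<close>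
  sees only the projection to that subspace, which is the compression.
\<close>

lemma norm_coefficient_le:
  assumes f: "f \<in> \<AA>" and y: "y \<in> N E x"
  shows "norm (cinner (M f x) y) \<le> norm x * norm y * compression_norm E x f"
proof -
  \<comment> \<open>for \<open>y = 0\<close> division by zero makes \<open>u = 0\<close>, and \<open>yu\<close> still holds\<close>
  define u where "u = (1 / norm y) *\<^sub>R y"
  have yu: "y = norm y *\<^sub>R u" by (simp add: u_def)
  have u: "u \<in> N E x" unfolding u_def
    by (intro subspace_scale csubspace_imp_subspace N_csubspace y)
  have nu: "norm u \<le> 1" by (simp add: u_def)
  have "cinner (M f x) u = cinner x (compression E x f u)"
    using cinner_orth_proj(2)[OF cyclic_csubspace cyclic_closed generator_in_cyclic]
    by (simp add: adjoint_M f compression_eq_orth_proj_cyclic[OF f u])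
  hence "norm (cinner (M f x) u) \<le> norm x * norm (compression E x f u)"
    by (simp add: cinner_Cauchy_Schwarz)
  also have "\<dots> \<le> norm x * compression_norm E x f"
    by (intro mult_left_mono norm_compression_le_compression_norm f u nu norm_ge_zero)
  finally have *: "norm (cinner (M f x) u) \<le> norm x * compression_norm E x f" .
  have "norm (cinner (M f x) y) = norm y * norm (cinner (M f x) u)"
    by (subst yu) (simp add: scaleR_scaleC cinner_scaleC_right norm_mult)
  also have "\<dots> \<le> norm y * (norm x * compression_norm E x f)"
    by (intro mult_left_mono * norm_ge_zero)
  finally show ?thesis by (simp add: mult_ac)
qed

text \<open>
  A functional vanishing on an ideal also vanishes on \<open>g f\<close> for \<open>g\<close> in the ideal, so \<open>y\<close> is orthogonal to
  \<open>M g\<close> applied to the orbit of \<open>x\<close>, and by continuity to its closure.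
\<close>

lemma orth_proj_in_N:
  assumes "\<And>g. g \<in> J E \<Longrightarrow> cinner (M g x) y = 0"
  shows "orth_proj (cyclic ev \<AA> x) y \<in> N E x"
  unfolding N_iff
proof (intro conjI ballI)
  let ?L = "cyclic ev \<AA> x"
  note L = cyclic_csubspace[of x] cyclic_closed[of x]
  show "orth_proj ?L y \<in> ?L" by (rule orth_proj_in[OF L])
  fix g z assume g: "g \<in> J E" and z: "z \<in> ?L"
  have "cinner (M g z) y = 0"
  proof (rule cyclic_induct[OF z])
    have "continuous_on UNIV (\<lambda>z. cinner (M g z) y)"
      by (rule continuous_on_compose2[OF continuous_cinner_left[of UNIV]])
        (use linear_continuous_on M_bounded_linear J_subset[OF g] in auto)
    thus "closed {z. cinner (M g z) y = 0}"
      by (intro closed_Collect_eq continuous_on_const)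
    show "cinner (M g (M f x)) y = 0" if "f \<in> \<AA>" for f
      using assms[OF J_mult[OF g that]] by (simp add: M_mult J_subset[OF g] that)
  qed
  moreover have "cinner (M g z) (orth_proj ?L y) = cinner (M g z) y"
    by (intro cinner_orth_proj(2) L cyclic_invariant J_subset[OF g] z)
  ultimately show "cinner (orth_proj ?L y) (M g z) = 0" by (subst cinner_commute) simp
qed

text \<open>
  Projecting \<open>y\<close> to the cyclic subspace of \<open>x\<close> changes none of the values \<open>cinner (M f x) y\<close>, does not increase
  the norm, and brings the vector into \<open>N\<close>.
\<close>

lemma norm_state_le_compression_norm:
  assumes f: "f \<in> \<AA>" and vanish: "\<And>g. g \<in> J E \<Longrightarrow> cinner (M g x) y = 0"
  shows "norm (cinner (M f x) y) \<le> norm x * norm y * compression_norm E x f"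
proof -
  let ?L = "cyclic ev \<AA> x"
  note L = cyclic_csubspace[of x] cyclic_closed[of x]
  note nn = compression_norm_nonneg[OF f, of E x]
  have "norm (cinner (M f x) y) = norm (cinner (M f x) (orth_proj ?L y))"
    by (simp add: cinner_orth_proj(2) L orbit_in_cyclic f)
  also have "\<dots> \<le> norm x * norm (orth_proj ?L y) * compression_norm E x f"
    by (intro norm_coefficient_le f orth_proj_in_N vanish)
  also have "\<dots> \<le> norm x * norm y * compression_norm E x f"
    by (intro mult_right_mono mult_left_mono norm_orth_proj_le L nn norm_ge_zero)
  finally show ?thesis .
qed

section \<open>Functionals on the quotient by the ideal\<close>

text \<open>
  Induction on the point set. When a point \<open>l\<close> is added, either the smaller ideal is the old
  one and \<open>l\<close> gets coefficient zero, or the old ideal contains some \<open>e\<close> with \<open>e l \<noteq> 0\<close>; subtracting the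
  multiple of the evaluation at \<open>l\<close> that kills \<open>e\<close> leaves a functional vanishing on the old ideal.
\<close>

lemma functional_vanishing_on_ideal:
  assumes "finite E" "functional_on \<AA> \<psi>" "\<And>g. g \<in> J E \<Longrightarrow> \<psi> g = 0"
  obtains c where "\<And>f. f \<in> \<AA> \<Longrightarrow> \<psi> f = (\<Sum>l\<in>E. c l * f l)"
  using assms
proof (induction E arbitrary: \<psi> thesis rule: finite_induct)
  case empty
  thus ?case by (simp add: vanishing_ideal_def)
next
  case (insert l F)
  note lin = insert.prems(2)[unfolded functional_on_def]
  show ?case
  proof (cases "\<exists>e\<in>J F. e l \<noteq> 0")
    case False
    hence "J F \<subseteq> J (insert l F)" by (auto simp: vanishing_ideal_def)
    hence "\<And>g. g \<in> J F \<Longrightarrow> \<psi> g = 0" using insert.prems(3) by blast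
    then obtain c where c: "\<And>f. f \<in> \<AA> \<Longrightarrow> \<psi> f = (\<Sum>m\<in>F. c m * f m)"
      using insert.IH[OF _ insert.prems(2)] by blast
    have "\<psi> f = (\<Sum>m\<in>insert l F. (c(l := 0)) m * f m)" if "f \<in> \<AA>" for f
    proof -
      have "(\<Sum>m\<in>F. (c(l := 0)) m * f m) = (\<Sum>m\<in>F. c m * f m)"
        by (rule sum.cong) (use insert.hyps in auto)
      thus ?thesis using c[OF that] insert.hyps by simp
    qed
    thus ?thesis by (rule insert.prems(1))
  next
    case True
    then obtain e where e: "e \<in> J F" "e l \<noteq> 0" by blast
    define b where "b = \<psi> e / e l"
    define \<psi>' where "\<psi>' f = \<psi> f - b * f l" for f
    have lin': "functional_on \<AA> \<psi>'"
      using lin by (auto simp: functional_on_def \<psi>'_def algebra_simps)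
    have "\<psi>' g = 0" if g: "g \<in> J F" for g
    proof -
      let ?a = "- (g l / e l)"
      have "(\<lambda>x. g x + ?a * e x) \<in> J F" by (intro J_add J_scale g e)
      hence "(\<lambda>x. g x + ?a * e x) \<in> J (insert l F)"
        using e(2) by (auto simp: vanishing_ideal_def)
      hence "\<psi> (\<lambda>x. g x + ?a * e x) = 0" by (rule insert.prems(3))
      moreover have "\<psi> (\<lambda>x. g x + ?a * e x) = \<psi> g + ?a * \<psi> e"
        using lin J_subset[OF g] J_subset[OF e(1)] scale_in[OF J_subset[OF e(1)], of ?a] by metis
      ultimately show ?thesis by (simp add: \<psi>'_def b_def)
    qed
    then obtain c where c: "\<And>f. f \<in> \<AA> \<Longrightarrow> \<psi>' f = (\<Sum>m\<in>F. c m * f m)"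
      using insert.IH[OF _ lin'] by blast
    have "\<psi> f = (\<Sum>m\<in>insert l F. (c(l := b)) m * f m)" if "f \<in> \<AA>" for f
    proof -
      have "(\<Sum>m\<in>F. (c(l := b)) m * f m) = (\<Sum>m\<in>F. c m * f m)"
        by (rule sum.cong) (use insert.hyps in auto)
      thus ?thesis using c[OF that] insert.hyps by (simp add: \<psi>'_def algebra_simps)
    qed
    thus ?thesis by (rule insert.prems(1))
  qed
qed

text \<open>
  The multiplication operators as elements of the normed space of bounded real-linear maps, where the
  Hahn-Banach theorem applies.
\<close>

definition B :: "('x \<Rightarrow> complex) \<Rightarrow> 'h \<Rightarrow>\<^sub>L 'h" where "B f = Blinfun (M f)"

lemma blinfun_apply_B: "f \<in> \<AA> \<Longrightarrow> blinfun_apply (B f) = M f"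
  by (simp add: B_def bounded_linear_Blinfun_apply M_bounded_linear)

lemma norm_B: "f \<in> \<AA> \<Longrightarrow> norm (B f) = onorm (M f)"
  by (simp add: norm_blinfun.rep_eq blinfun_apply_B)

lemma B_add: "f \<in> \<AA> \<Longrightarrow> g \<in> \<AA> \<Longrightarrow> B (\<lambda>x. f x + g x) = B f + B g"
  by (rule blinfun_eqI) (simp add: blinfun_apply_B add_in M_add plus_blinfun.rep_eq)

lemma B_scaleR: "f \<in> \<AA> \<Longrightarrow> B (\<lambda>x. complex_of_real r * f x) = r *\<^sub>R B f"
  by (rule blinfun_eqI)
    (simp add: blinfun_apply_B scale_in M_scale scaleR_blinfun.rep_eq scaleR_scaleC)

lemma mult_dist_eq_infdist:
  assumes f: "f \<in> \<AA>"
  shows "mult_dist ev f (J E) = infdist (B f) (B ` J E)"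
proof -
  have "onorm (\<lambda>h. M f h - M g h) = dist (B f) (B g)" if "g \<in> J E" for g
    by (simp add: dist_norm norm_blinfun.rep_eq minus_blinfun.rep_eq
        blinfun_apply_B f J_subset[OF that])
  moreover have "J E \<noteq> {}" using J_zero by blast
  ultimately show ?thesis
    by (simp add: mult_dist_def infdist_notempty image_image cong: image_cong_simp)
qed

lemma subspace_B_J: "subspace (B ` J E)"
  unfolding subspace_def
proof (intro conjI ballI allI)
  have "B (\<lambda>x. 0) = 0" by (rule blinfun_eqI) (simp add: blinfun_apply_B zero_in M_zero)
  thus "0 \<in> B ` J E" using J_zero by force
next
  fix x y assume "x \<in> B ` J E" "y \<in> B ` J E"
  then obtain f g where "f \<in> J E" "g \<in> J E" "x = B f" "y = B g" by blast
  thus "x + y \<in> B ` J E"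
    by (intro image_eqI[where x="\<lambda>x. f x + g x"]) (simp_all add: B_add J_subset J_add)
next
  fix c x assume "x \<in> B ` J E"
  then obtain f where "f \<in> J E" "x = B f" by blast
  thus "c *\<^sub>R x \<in> B ` J E"
    by (intro image_eqI[where x="\<lambda>x. complex_of_real c * f x"])
      (simp_all add: B_scaleR J_subset J_scale)
qed

text \<open>
  The real functional given by the Hahn-Banach theorem is the real part of a complex-linear
  \<open>\<psi>\<close>, and the norm bound passes to \<open>\<psi>\<close> by rotating its value to the positive axis.
\<close>

lemma norming_functional_exists:
  assumes f: "f \<in> \<AA>"
  obtains \<psi> where "functional_on \<AA> \<psi>" "\<And>g. g \<in> J E \<Longrightarrow> \<psi> g = 0"
    "\<And>g. g \<in> \<AA> \<Longrightarrow> norm (\<psi> g) \<le> onorm (M g)" "mult_dist ev f (J E) \<le> norm (\<psi> f)"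
proof -
  obtain \<phi> where \<phi>: "linear \<phi>" "\<And>x. \<phi> x \<le> norm x" "\<And>x. x \<in> B ` J E \<Longrightarrow> \<phi> x = 0"
      "\<phi> (B f) = infdist (B f) (B ` J E)"
    using Hahn_Banach_infdist[OF subspace_B_J] by blast
  define \<psi> where
    "\<psi> g = complex_of_real (\<phi> (B g)) - \<i> * complex_of_real (\<phi> (B (\<lambda>x. \<i> * g x)))" for g
  have add: "\<psi> (\<lambda>x. g x + h x) = \<psi> g + \<psi> h" if "g \<in> \<AA>" "h \<in> \<AA>" for g h
    using that
    by (simp add: \<psi>_def distrib_left B_add scale_in linear_add[OF \<phi>(1)] algebra_simps)
  have scaleR: "\<psi> (\<lambda>x. complex_of_real r * g x) = of_real r * \<psi> g" if "g \<in> \<AA>" for g r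
  proof -
    have "(\<lambda>x. \<i> * (complex_of_real r * g x)) = (\<lambda>x. complex_of_real r * (\<i> * g x))"
      by (simp only: mult.left_commute)
    thus ?thesis
      using that by (simp add: \<psi>_def B_scaleR scale_in linear_scale[OF \<phi>(1)] right_diff_distrib)
  qed
  have scale_i: "\<psi> (\<lambda>x. \<i> * g x) = \<i> * \<psi> g" if "g \<in> \<AA>" for g
  proof -
    have "B (\<lambda>x. \<i> * (\<i> * g x)) = - B g"
      using B_scaleR[OF that, of "-1"] by (simp flip: mult.assoc)
    thus ?thesis by (simp add: \<psi>_def linear_neg[OF \<phi>(1)] algebra_simps)
  qed
  have scale: "\<psi> (\<lambda>x. c * g x) = c * \<psi> g" if g: "g \<in> \<AA>" for g c
  proof -
    have "(\<lambda>x. c * g x) = (\<lambda>x. complex_of_real (Re c) * g x + \<i> * (complex_of_real (Im c) * g x))"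
      by (subst complex_eq[of c]) (simp add: algebra_simps)
    hence "\<psi> (\<lambda>x. c * g x) = of_real (Re c) * \<psi> g + \<i> * (of_real (Im c) * \<psi> g)"
      by (simp add: add scaleR scale_i scale_in g)
    also have "\<dots> = (of_real (Re c) + \<i> * of_real (Im c)) * \<psi> g" by (simp add: algebra_simps)
    finally show ?thesis by (simp flip: complex_eq)
  qed
  have Re\<psi>: "Re (\<psi> g) = \<phi> (B g)" for g by (simp add: \<psi>_def)
  show ?thesis
  proof (rule that)
    show "functional_on \<AA> \<psi>" by (simp add: functional_on_def add scale)
    show "\<psi> g = 0" if "g \<in> J E" for g
      using \<phi>(3) that J_scale[OF that, of \<i>] by (simp add: \<psi>_def)
    show "norm (\<psi> g) \<le> onorm (M g)" if g: "g \<in> \<AA>" for g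
    proof -
      obtain u where u: "norm u = 1" "u * \<psi> g = of_real (norm (\<psi> g))"
        by (rule rotate_to_norm)
      have "norm (\<psi> g) = \<phi> (B (\<lambda>x. u * g x))"
        using Re\<psi>[of "\<lambda>x. u * g x"] by (simp add: scale g u)
      also have "\<dots> \<le> onorm (M (\<lambda>x. u * g x))"
        using \<phi>(2) by (simp add: scale_in g flip: norm_B)
      also have "\<dots> = onorm (M g)"
        by (simp add: onorm_def M_scale g norm_scaleC u)
      finally show ?thesis .
    qed
    show "mult_dist ev f (J E) \<le> norm (\<psi> f)"
      using Re\<psi>[of f] complex_Re_le_cmod[of "\<psi> f"] by (simp add: \<phi>(4) mult_dist_eq_infdist f)
  qed
qed

text \<open>
  The factor \<open>r\<close> makes the norm of the functional strictly less than one, as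
  the property \<open>\<AA>\<^sub>1(1)\<close> demands.
\<close>

lemma scaled_mult_dist_le_compression_norm:
  assumes A1: "property_A1_1 ev \<AA>" and E: "finite E" and f: "f \<in> \<AA>" and r: "0 < r" "r < 1"
  obtains x where "r * mult_dist ev f (J E) \<le> compression_norm E x f"
proof -
  obtain \<psi> where \<psi>: "functional_on \<AA> \<psi>" "\<And>g. g \<in> J E \<Longrightarrow> \<psi> g = 0"
    "\<And>g. g \<in> \<AA> \<Longrightarrow> norm (\<psi> g) \<le> onorm (M g)" "mult_dist ev f (J E) \<le> norm (\<psi> f)"
    using norming_functional_exists[OF f] by blast
  obtain c where c: "\<And>g. g \<in> \<AA> \<Longrightarrow> \<psi> g = (\<Sum>l\<in>E. c l * g l)"
    using functional_vanishing_on_ideal[OF E \<psi>(1,2)] by blast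
  define \<phi> where "\<phi> g = (\<Sum>l\<in>E. (of_real r * c l) * g l)" for g
  have \<phi>: "\<phi> g = of_real r * \<psi> g" if "g \<in> \<AA>" for g
    by (simp add: \<phi>_def c that sum_distrib_left mult.assoc)
  have "functional_on \<AA> \<phi>"
    by (auto simp: functional_on_def \<phi>_def sum.distrib sum_distrib_left algebra_simps)
  moreover have "weak_star_continuous_on ev \<AA> \<phi>"
    unfolding \<phi>_def by (rule weak_star_continuous_evaluations[OF E])
  moreover have "functional_norm ev \<AA> \<phi> < 1"
  proof -
    have "functional_norm ev \<AA> \<phi> \<le> r" unfolding functional_norm_def
    proof (rule cSUP_least)
      have "M (\<lambda>x. 0) = (\<lambda>h. 0)" by (rule ext) (rule M_zero)
      hence "onorm (M (\<lambda>x. 0)) \<le> 1" by (simp add: onorm_zero)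
      thus "{f \<in> \<AA>. onorm (M f) \<le> 1} \<noteq> {}" using zero_in by blast
      fix g assume g: "g \<in> {f \<in> \<AA>. onorm (M f) \<le> 1}"
      hence "norm (\<psi> g) \<le> 1" using \<psi>(3)[of g] by simp
      thus "norm (\<phi> g) \<le> r" using g r by (simp add: \<phi> norm_mult mult_left_le)
    qed
    thus ?thesis using r by simp
  qed
  ultimately obtain x y where xy: "norm x * norm y < 1" "\<And>g. g \<in> \<AA> \<Longrightarrow> \<phi> g = cinner (M g x) y"
    using A1 unfolding property_A1_1_def by blast
  have "r * mult_dist ev f (J E) \<le> r * norm (\<psi> f)" using \<psi>(4) r by simp
  also have "\<dots> = norm (cinner (M f x) y)"
    using r by (simp add: xy(2)[symmetric] \<phi> f norm_mult)
  also have "\<dots> \<le> norm x * norm y * compression_norm E x f"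
    by (rule norm_state_le_compression_norm[OF f])
      (simp add: xy(2)[symmetric] J_subset \<phi> \<psi>(2))
  also have "\<dots> \<le> compression_norm E x f"
    using mult_right_mono[of "norm x * norm y" 1, OF _ compression_norm_nonneg[OF f]] xy(1)
    by simp
  finally show ?thesis by (rule that)
qed

lemma NP_formula_holds:
  assumes A1: "property_A1_1 ev \<AA>" and E: "finite E" and f: "f \<in> \<AA>"
  shows "NP_formula ev \<AA> E f"
proof -
  let ?d = "mult_dist ev f (J E)"
  have "?d = (SUP h. compression_norm E h f)"
  proof (rule antisym)
    show "?d \<le> (SUP h. compression_norm E h f)"
    proof (rule field_le_mult_one_interval)
      fix r :: real assume "0 < r" "r < 1"
      then obtain x where x: "r * ?d \<le> compression_norm E x f"
        using scaled_mult_dist_le_compression_norm[OF A1 E f] by blast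
      also have "\<dots> \<le> (SUP h. compression_norm E h f)"
        by (rule cSUP_upper)
          (use compression_norm_le_mult_dist[OF f] in \<open>auto intro!: bdd_aboveI2[where M="?d"]\<close>)
      finally show "r * ?d \<le> (SUP h. compression_norm E h f)" .
    qed
    show "(SUP h. compression_norm E h f) \<le> ?d"
      by (rule cSUP_least) (use compression_norm_le_mult_dist[OF f] in auto)
  qed
  thus ?thesis by (simp add: NP_formula_def CycLat_def image_image)
qed

end

theorem theorem3p4:
  fixes ev :: "'h::complex_hilbert \<Rightarrow> 'x \<Rightarrow> complex"
    and k :: "'x \<Rightarrow> 'h"
    and \<AA> :: "('x \<Rightarrow> complex) set"
    and E :: "'x set"
  assumes "rkhs ev k"
    and "dual_algebra ev \<AA>"
    and "property_A1_1 ev \<AA>"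
    and "finite E"
    and "separates \<AA> E"
  shows "(\<forall>f\<in>\<AA>.
           mult_dist ev f (vanishing_ideal \<AA> E) =
             (SUP L\<in>CycLat ev \<AA>.
               restr_norm (NP_space ev \<AA> E L)
                 (\<lambda>x. orth_proj (NP_space ev \<AA> E L) (hilbert_adjoint (mult_op ev f) x))))
         \<and> (\<forall>K. kernel_family ev k \<AA> K \<longrightarrow> nevanlinna_pick_family ev k \<AA> K)"
proof -
  interpret multiplier_algebra ev k \<AA> by unfold_locales fact+
  have "NP_formula ev \<AA> F f" if "finite F" "f \<in> \<AA>" for F f
    using NP_formula_holds[OF assms(3) that] .
  thus ?thesis using assms(4) unfolding nevanlinna_pick_family_def NP_formula_def by blast
qed

end
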